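(* Let $f:\mathbb{R}^n\to\mathbb{R}$ be a closed proper $\mu$-strongly convex function ($\mu>0$), $T:\mathbb{R}^n\to\mathbb{R}^m$ a linear map such that $T^*T$ is positive definite, $b\in\mathbb{R}^m$, and $\mathcal{K}\subseteq\mathbb{R}^m$ a regular closed convex cone. Suppose $e\in\operatorname{int}\mathcal{K}$ and $c_D>0$ are such that the dual problem $$(\mathrm{D})\quad\min_{y\in\mathbb{R}^m}\ h(y):=(f^*\circ T^* )(y)+\langle b,y\rangle\quad\text{s.t. } y\in\mathcal{K}^*$$ has at least one optimal solution $y_{\mathrm{opt}}$ with $\langle e,y_{\mathrm{opt}}\rangle\le c_D$, and let $d^*$ be its optimal value. Let $\{(x_k,y_k)\}\subseteq\mathbb{R}^n\times\mathbb{R}^m$ be a sequence such that, for every $k$, $y_k\in\mathcal{K}^*$, $\langle e,y_k\rangle\le c_D$ and $x_k=\nabla f^*(T^*y_k)$, and such that $h(y_k)\to d^*$. Then, for every $k$, $$\|x_k-x_{\mathrm{opt}}\|\le\sqrt{\frac{2\|T\|_{\mathrm{op}}^2}{\mu\,\lambda_{\min}(T^*T)}}\ \sqrt{h(y_k)-d^*},$$ where $\lambda_{\min}(T^*T)>0$ is the minimum eigenvalue of $T^*T$ and $x_{\mathrm{opt}}$ is the (unique) optimal solution of $\min_{x\in\mathbb{R}^n}\{f(x)\mid Tx+b\in\mathcal{K}\}$.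
   Context: $\mathbb{R}^n$ and $\mathbb{R}^m$ carry arbitrary inner products $\langle\cdot,\cdot\rangle$ with induced norms $\|\cdot\|$; the adjoint $T^*$, conjugates, gradients and dual cones are taken with respect to them. $\|T\|_{\mathrm{op}}=\sup_{x\ne0}\|Tx\|/\|x\|$. A closed convex cone is regular if it is pointed ($\mathcal{K}\cap-\mathcal{K}=\{0\}$) and has nonempty interior. $\mathcal{K}^*=\{y\mid\langle x,y\rangle\ge 0\ \forall x\in\mathcal{K}\}$. $f$ is $\mu$-strongly convex if $f(\theta x+(1-\theta)y)\le\theta f(x)+(1-\theta)f(y)-\frac{\mu}{2}\theta(1-\theta)\|x-y\|^2$ for all $x,y$ and $\theta\in[0,1]$. $f^*(s)=\sup_x\{\langle s,x\rangle-f(x)\}$ is the conjugate of $f$; it is finite and differentiable on $\mathbb{R}^n$ here. *)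

theory Defs
  imports "HOL-Analysis.Analysis"
begin

text \<open>
  The spaces \<open>\<real>\<^sup>n\<close> and \<open>\<real>\<^sup>m\<close> with arbitrary inner products are rendered by two independent type
  variables of class \<^class>\<open>euclidean_space\<close>: a finite-dimensional real vector space with some
  inner product, whose norm is the induced one.
\<close>

definition strongly_convex :: "real \<Rightarrow> ('a::real_inner \<Rightarrow> real) \<Rightarrow> bool" where
  "strongly_convex \<mu> f \<longleftrightarrow>
    (\<forall>x y. \<forall>\<theta>\<in>{0..1}. f (\<theta> *\<^sub>R x + (1 - \<theta>) *\<^sub>R y)
        \<le> \<theta> * f x + (1 - \<theta>) * f y - \<mu> / 2 * \<theta> * (1 - \<theta>) * (norm (x - y))\<^sup>2)"

text \<open>
  The supremum is taken in the reals, where it is meaningful only if the family is bounded above.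
  For strongly convex functions it is: see \<open>bdd_above_convex_conjugate\<close> below.
\<close>

definition convex_conjugate :: "('a::real_inner \<Rightarrow> real) \<Rightarrow> 'a \<Rightarrow> real" where
  "convex_conjugate f s = (SUP x. s \<bullet> x - f x)"

definition dual_cone :: "'a::real_inner set \<Rightarrow> 'a set" where
  "dual_cone K = {y. \<forall>x\<in>K. 0 \<le> x \<bullet> y}"

definition regular_cone :: "'a::euclidean_space set \<Rightarrow> bool" where
  "regular_cone K \<longleftrightarrow>
    closed K \<and> convex_cone K \<and> K \<inter> uminus ` K = {0} \<and> interior K \<noteq> {}"

definition dual_objective ::
  "('a::euclidean_space \<Rightarrow> real) \<Rightarrow> ('a \<Rightarrow> 'b::euclidean_space) \<Rightarrow> 'b \<Rightarrow> 'b \<Rightarrow> real" where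
  "dual_objective f T b y = convex_conjugate f (adjoint T y) + b \<bullet> y"

definition eigenvalue :: "('a::real_vector \<Rightarrow> 'a) \<Rightarrow> real \<Rightarrow> bool" where
  "eigenvalue A l \<longleftrightarrow> (\<exists>v. v \<noteq> 0 \<and> A v = l *\<^sub>R v)"

definition min_eigenvalue :: "('a::real_vector \<Rightarrow> 'a) \<Rightarrow> real" where
  "min_eigenvalue A = (LEAST l. eigenvalue A l)"

lemma strongly_convex_imp_convex:
  assumes "strongly_convex \<mu> f" "0 \<le> \<mu>"
  shows "convex_on UNIV f"
proof (rule convex_onI)
  fix t :: real and x y :: 'a
  assume t: "0 < t" "t < 1"
  then have "t \<in> {0..1}" by simp
  with assms(1) have "f (t *\<^sub>R y + (1 - t) *\<^sub>R x)
      \<le> t * f y + (1 - t) * f x - \<mu> / 2 * t * (1 - t) * (norm (y - x))\<^sup>2"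
    unfolding strongly_convex_def by blast
  moreover have "0 \<le> \<mu> / 2 * t * (1 - t) * (norm (y - x))\<^sup>2"
    using t assms(2) by simp
  ultimately show "f ((1 - t) *\<^sub>R x + t *\<^sub>R y) \<le> (1 - t) * f x + t * f y"
    by (simp add: add.commute)
qed simp

lemma bdd_above_convex_conjugate:
  fixes f :: "'a::euclidean_space \<Rightarrow> real"
  assumes sc: "strongly_convex \<mu> f" and mu: "0 < \<mu>"
  shows "bdd_above (range (\<lambda>x. s \<bullet> x - f x))"
proof -
  have "continuous_on UNIV f"
    using strongly_convex_imp_convex[OF sc] mu by (intro convex_on_continuous) auto
  then have "continuous_on (cball 0 1) f"
    by (rule continuous_on_subset) simp
  then obtain z where "\<forall>x\<in>cball 0 1. f z \<le> f x"
    using continuous_attains_inf[of "cball (0::'a) 1" f] by auto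
  then have z: "\<And>x. norm x \<le> 1 \<Longrightarrow> f z \<le> f x"
    by simp
  define A where "A = norm s + \<bar>f z\<bar> + \<bar>f 0\<bar> + \<mu> / 2"
  have "s \<bullet> x - f x \<le> norm s + \<bar>f z\<bar> + A\<^sup>2 / (2 * \<mu>)" for x
  proof -
    define r where "r = norm x"
    have cs: "s \<bullet> x \<le> norm s * r"
      unfolding r_def by (rule norm_cauchy_schwarz)
    have sq: "A * r - \<mu> / 2 * r\<^sup>2 \<le> A\<^sup>2 / (2 * \<mu>)"
    proof -
      have "0 \<le> (\<mu> * r - A)\<^sup>2" by simp
      then show ?thesis using mu by (simp add: field_simps power2_eq_square)
    qed
    have nn: "0 \<le> A\<^sup>2 / (2 * \<mu>)" using mu by simp
    show ?thesis
    proof (cases "r \<le> 1")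
      case True
      then have "f z \<le> f x" using z by (simp add: r_def)
      moreover have "norm s * r \<le> norm s" using True by (simp add: mult_left_le)
      ultimately show ?thesis using cs nn by linarith
    next
      case False
      then have r: "r > 1" by simp
      have "1 / r \<in> {0..1}" using r by simp
      then have "f ((1 / r) *\<^sub>R x + (1 - 1 / r) *\<^sub>R 0)
          \<le> (1 / r) * f x + (1 - 1 / r) * f 0 - \<mu> / 2 * (1 / r) * (1 - 1 / r) * (norm (x - 0))\<^sup>2"
        using sc unfolding strongly_convex_def by blast
      moreover have "f z \<le> f ((1 / r) *\<^sub>R x + (1 - 1 / r) *\<^sub>R 0)"
        using r by (intro z) (simp add: r_def)
      ultimately have "f z
          \<le> (1 / r) * f x + (1 - 1 / r) * f 0 - \<mu> / 2 * (1 / r) * (1 - 1 / r) * r\<^sup>2"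
        by (simp add: r_def)
      then have "r * f z
          \<le> r * ((1 / r) * f x + (1 - 1 / r) * f 0 - \<mu> / 2 * (1 / r) * (1 - 1 / r) * r\<^sup>2)"
        using r by (intro mult_left_mono) auto
      also have "\<dots> = f x + (r - 1) * f 0 - \<mu> / 2 * (r\<^sup>2 - r)"
        using r by (simp add: field_simps power2_eq_square)
      finally have le: "r * f z \<le> f x + (r - 1) * f 0 - \<mu> / 2 * (r\<^sup>2 - r)" .
      have "(r - 1) * f 0 \<le> r * \<bar>f 0\<bar>"
      proof -
        have "(r - 1) * f 0 \<le> (r - 1) * \<bar>f 0\<bar>"
          using r by (intro mult_left_mono) auto
        also have "\<dots> \<le> r * \<bar>f 0\<bar>"
          by (intro mult_right_mono) auto
        finally show ?thesis .
      qed
      moreover have "- (r * f z) \<le> r * \<bar>f z\<bar>"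
        using r by (simp add: abs_if)
      moreover have "A * r = norm s * r + r * \<bar>f z\<bar> + r * \<bar>f 0\<bar> + \<mu> / 2 * r"
        by (simp add: A_def algebra_simps)
      moreover have "\<mu> / 2 * (r\<^sup>2 - r) = \<mu> / 2 * r\<^sup>2 - \<mu> / 2 * r"
        by (simp add: algebra_simps)
      ultimately have "s \<bullet> x - f x \<le> A\<^sup>2 / (2 * \<mu>)"
        using le cs sq by linarith
      moreover have "0 \<le> norm s" by simp
      ultimately show ?thesis by linarith
    qed
  qed
  then show ?thesis by (intro bdd_aboveI2)
qed

end

theory Submission
  imports Defs
begin

text \<open>
  Write \<open>h\<close> for the dual objective. Strong convexity of \<open>f\<close> makes \<open>x \<mapsto> \<langle>s, x\<rangle> - f x\<close> attain its
  supremum \<open>f\<^sup>* s\<close> with quadratic decay \<open>\<mu>/2 \<parallel>x - x\<^sub>s\<parallel>\<^sup>2\<close> away from the maximizer \<open>x\<^sub>s = \<nabla>f\<^sup>* s\<close>.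
  At a dual solution \<open>y\<^sub>o\<^sub>p\<^sub>t\<close> with \<open>x\<^sub>o\<^sub>p\<^sub>t = \<nabla>f\<^sup>*(T\<^sup>* y\<^sub>o\<^sub>p\<^sub>t)\<close>, first-order optimality over the cone
  says that \<open>T x\<^sub>o\<^sub>p\<^sub>t + b\<close> lies in the bidual cone \<open>\<K>\<close> and is orthogonal to \<open>y\<^sub>o\<^sub>p\<^sub>t\<close>; hence there is
  no duality gap and \<open>x\<^sub>o\<^sub>p\<^sub>t\<close> is the primal solution. For dual feasible \<open>y\<close> with \<open>x = \<nabla>f\<^sup>*(T\<^sup>* y)\<close>,
  \<open>h y - d\<^sup>* = f\<^sup>*(T\<^sup>* y) + f x\<^sub>o\<^sub>p\<^sub>t - \<langle>T\<^sup>* y, x\<^sub>o\<^sub>p\<^sub>t\<rangle> + \<langle>y, T x\<^sub>o\<^sub>p\<^sub>t + b\<rangle> \<ge> \<mu>/2 \<parallel>x - x\<^sub>o\<^sub>p\<^sub>t\<parallel>\<^sup>2\<close>.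
  The claim follows because \<open>\<lambda>\<^sub>m\<^sub>i\<^sub>n(T\<^sup>* T) \<le> \<parallel>T\<parallel>\<^sup>2\<close>.
\<close>

text \<open>Carries out the passage \<open>t\<close> to 0 from the right once and for all, so that
  each first-order argument below reduces to an algebraic estimate with an error of order
  \<open>t\<close>.\<close>

lemma nonpos_if_le_small_mult:
  fixes a c :: real
  assumes "\<And>t. 0 < t \<Longrightarrow> t \<le> 1 \<Longrightarrow> a \<le> t * c"
  shows "a \<le> 0"
proof (rule tendsto_lowerbound)
  show "((\<lambda>t. t * c) \<longlongrightarrow> 0) (at_right 0)"
    by (auto intro!: tendsto_eq_intros)
  show "\<forall>\<^sub>F t in at_right 0. a \<le> t * c"
    using assms by (auto simp: eventually_at_right_field intro!: exI[of _ 1])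
qed simp

section \<open>Conjugates of strongly convex functions\<close>

lemma strongly_convex_imp_continuous:
  fixes f :: "'a::euclidean_space \<Rightarrow> real"
  assumes "strongly_convex \<mu> f" "0 \<le> \<mu>"
  shows "continuous_on A f"
  using convex_on_continuous[OF _ strongly_convex_imp_convex[OF assms]] continuous_on_subset
  by fastforce

lemma le_convex_conjugate:
  fixes f :: "'a::euclidean_space \<Rightarrow> real"
  assumes "strongly_convex \<mu> f" "0 < \<mu>"
  shows "s \<bullet> x - f x \<le> convex_conjugate f s"
  unfolding convex_conjugate_def by (rule cSUP_upper[OF UNIV_I bdd_above_convex_conjugate[OF assms]])

lemma strongly_concave_combination:
  assumes "strongly_convex \<mu> f" "0 \<le> t" "t \<le> 1"
  shows "t * (s \<bullet> x - f x) + (1 - t) * (s \<bullet> z - f z) + \<mu> / 2 * t * (1 - t) * (norm (x - z))\<^sup>2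
      \<le> s \<bullet> (t *\<^sub>R x + (1 - t) *\<^sub>R z) - f (t *\<^sub>R x + (1 - t) *\<^sub>R z)"
proof -
  have "f (t *\<^sub>R x + (1 - t) *\<^sub>R z)
      \<le> t * f x + (1 - t) * f z - \<mu> / 2 * t * (1 - t) * (norm (x - z))\<^sup>2"
    using assms unfolding strongly_convex_def by simp
  then show ?thesis
    by (simp add: inner_add_right right_diff_distrib)
qed

text \<open>The points whose value is within 1 of the supremum form a closed nonempty set, and
  strong concavity bounds it; hence it is compact and a maximizer exists.\<close>

lemma convex_conjugate_attained:
  fixes f :: "'a::euclidean_space \<Rightarrow> real"
  assumes sc: "strongly_convex \<mu> f" and mu: "0 < \<mu>"
  obtains z where "convex_conjugate f s = s \<bullet> z - f z"
proof -
  define M where "M = convex_conjugate f s"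
  define S where "S = {x. M - 1 \<le> s \<bullet> x - f x}"
  have cont: "continuous_on A (\<lambda>x. s \<bullet> x - f x)" for A
    using strongly_convex_imp_continuous[OF sc] mu by (intro continuous_intros) auto
  obtain w where w: "w \<in> S"
  proof -
    have "M - 1 < (SUP x. s \<bullet> x - f x)"
      by (simp add: M_def convex_conjugate_def)
    then obtain w where "M - 1 < s \<bullet> w - f w"
      by (subst (asm) less_cSUP_iff[OF _ bdd_above_convex_conjugate[OF sc mu]]) auto
    then show ?thesis by (intro that[of w]) (simp add: S_def)
  qed
  have "(norm (x - w))\<^sup>2 \<le> 8 / \<mu>" if "x \<in> S" for x
  proof -
    \<comment> \<open>The value at the midpoint is at most \<open>M\<close>, and both endpoints have
      values at least \<open>M - 1\<close>, so the midpoint bonus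
      \<open>\<mu> / 8 * (norm (x - w))\<^sup>2\<close> is at most 1.\<close>
    let ?m = "(1/2) *\<^sub>R x + (1 - 1/2) *\<^sub>R w"
    have "1/2 * (s \<bullet> x - f x) + (1 - 1/2) * (s \<bullet> w - f w)
        + \<mu> / 2 * (1/2) * (1 - 1/2) * (norm (x - w))\<^sup>2 \<le> s \<bullet> ?m - f ?m"
      by (rule strongly_concave_combination[OF sc]) auto
    also have "\<dots> \<le> M"
      unfolding M_def by (rule le_convex_conjugate[OF sc mu])
    finally have "(s \<bullet> x - f x) + (s \<bullet> w - f w) + \<mu> / 4 * (norm (x - w))\<^sup>2 \<le> 2 * M"
      by (simp add: field_simps)
    moreover have "2 * (M - 1) \<le> (s \<bullet> x - f x) + (s \<bullet> w - f w)"
      using that w unfolding S_def by simp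
    ultimately have "\<mu> / 4 * (norm (x - w))\<^sup>2 \<le> 2" by argo
    then show ?thesis using mu by (simp add: field_simps)
  qed
  then have "dist w x \<le> sqrt (8 / \<mu>)" if "x \<in> S" for x
    using that by (metis dist_commute dist_norm real_le_rsqrt)
  then have "bounded S"
    unfolding bounded_def by blast
  moreover have "closed S"
    unfolding S_def by (intro closed_Collect_le cont continuous_intros)
  ultimately have "compact S"
    by (simp add: compact_eq_bounded_closed)
  then obtain z where z: "z \<in> S" "\<forall>x\<in>S. s \<bullet> x - f x \<le> s \<bullet> z - f z"
    using continuous_attains_sup[of S "\<lambda>x. s \<bullet> x - f x"] w cont by auto
  have "s \<bullet> x - f x \<le> s \<bullet> z - f z" for x
    using z unfolding S_def by (cases "x \<in> S") (auto simp: S_def)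
  then have "convex_conjugate f s \<le> s \<bullet> z - f z"
    unfolding convex_conjugate_def by (intro cSUP_least) auto
  then show ?thesis
    using le_convex_conjugate[OF sc mu, of s z] by (intro that[of z]) simp
qed

text \<open>Compare the maximizer \<open>z\<close> with points of the segment towards
  \<open>x\<close>. After division by \<open>t\<close>, the strong concavity bonus keeps the factor
  \<open>1 - t\<close>, which tends to 1 at \<open>z\<close>.\<close>

lemma convex_conjugate_quadratic_growth:
  fixes f :: "'a::euclidean_space \<Rightarrow> real"
  assumes sc: "strongly_convex \<mu> f" and mu: "0 < \<mu>"
    and z: "convex_conjugate f s = s \<bullet> z - f z"
  shows "s \<bullet> x - f x + \<mu> / 2 * (norm (x - z))\<^sup>2 \<le> convex_conjugate f s"
proof -
  let ?g = "\<lambda>x. s \<bullet> x - f x" and ?D = "\<mu> / 2 * (norm (x - z))\<^sup>2"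
  have "?g x + ?D - ?g z \<le> 0"
  proof (rule nonpos_if_le_small_mult)
    fix t :: real assume t: "0 < t" "t \<le> 1"
    have "t * ?g x + (1 - t) * ?g z + \<mu> / 2 * t * (1 - t) * (norm (x - z))\<^sup>2 \<le> ?g z"
      using strongly_concave_combination[OF sc, of t s x z] t
        le_convex_conjugate[OF sc mu, of s "t *\<^sub>R x + (1 - t) *\<^sub>R z"] z by simp
    then have "t * (?g x + ?D - ?g z) \<le> t * (t * ?D)"
      by (simp add: field_simps)
    then show "?g x + ?D - ?g z \<le> t * ?D"
      using t by simp
  qed
  then show ?thesis using z by simp
qed

text \<open>Smoothness of the conjugate with constant \<open>1 / \<mu>\<close>, the maximizer
  \<open>z\<close> serving as gradient. In each term of the supremum, Young's inequality plays the
  linear gain \<open>d \<bullet> (x - z)\<close> off against the quadratic decay.\<close>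

lemma convex_conjugate_descent:
  fixes f :: "'a::euclidean_space \<Rightarrow> real"
  assumes sc: "strongly_convex \<mu> f" and mu: "0 < \<mu>"
    and z: "convex_conjugate f s = s \<bullet> z - f z"
  shows "convex_conjugate f (s + d) \<le> convex_conjugate f s + d \<bullet> z + (norm d)\<^sup>2 / (2 * \<mu>)"
proof -
  have "(s + d) \<bullet> x - f x \<le> convex_conjugate f s + d \<bullet> z + (norm d)\<^sup>2 / (2 * \<mu>)" for x
  proof -
    let ?r = "norm (x - z)"
    have "d \<bullet> (x - z) \<le> norm d * ?r"
      by (rule norm_cauchy_schwarz)
    also have "\<dots> \<le> \<mu> / 2 * ?r\<^sup>2 + (norm d)\<^sup>2 / (2 * \<mu>)"
    proof -
      have "0 \<le> (\<mu> * ?r - norm d)\<^sup>2" by simp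
      then show ?thesis using mu by (simp add: field_simps power2_eq_square)
    qed
    finally show ?thesis
      using convex_conjugate_quadratic_growth[OF assms, of x]
      by (simp add: inner_add_left inner_diff_right)
  qed
  then show ?thesis
    unfolding convex_conjugate_def[of f "s + d"] by (intro cSUP_least) auto
qed

text \<open>For a maximizer \<open>z\<close>, the Fenchel-Young inequality makes
  \<open>u = s\<close> a minimum of \<open>convex_conjugate f u - u \<bullet> z\<close>. Its
  derivative there vanishes, which forces \<open>x = z\<close>.\<close>

lemma gradient_convex_conjugate_attains:
  fixes f :: "'a::euclidean_space \<Rightarrow> real"
  assumes sc: "strongly_convex \<mu> f" and mu: "0 < \<mu>"
    and grad: "GDERIV (convex_conjugate f) s :> x"
  shows "convex_conjugate f s = s \<bullet> x - f x"
proof -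
  obtain z where z: "convex_conjugate f s = s \<bullet> z - f z"
    using convex_conjugate_attained[OF sc mu] .
  have "((\<lambda>u. convex_conjugate f u - u \<bullet> z) has_derivative (\<lambda>h. h \<bullet> x - h \<bullet> z)) (at s)"
    using grad unfolding gderiv_def by (auto intro!: derivative_eq_intros)
  moreover have "\<forall>u\<in>UNIV. convex_conjugate f s - s \<bullet> z \<le> convex_conjugate f u - u \<bullet> z"
  proof
    fix u
    show "convex_conjugate f s - s \<bullet> z \<le> convex_conjugate f u - u \<bullet> z"
      using le_convex_conjugate[OF sc mu, of u z] z by linarith
  qed
  ultimately have "(\<lambda>h. h \<bullet> x - h \<bullet> z) = (\<lambda>h. 0)"
    by (intro differential_zero_maxmin[of s UNIV]) auto
  then have "(x - z) \<bullet> (x - z) = 0"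
    by (metis inner_diff_right)
  then show ?thesis using z by simp
qed

section \<open>Dual cones and first-order optimality in the dual problem\<close>

lemma dual_cone_add: "u \<in> dual_cone K \<Longrightarrow> v \<in> dual_cone K \<Longrightarrow> u + v \<in> dual_cone K"
  by (simp add: dual_cone_def inner_add_right)

lemma dual_cone_scaleR: "u \<in> dual_cone K \<Longrightarrow> 0 \<le> c \<Longrightarrow> c *\<^sub>R u \<in> dual_cone K"
  by (simp add: dual_cone_def)

text \<open>A hyperplane separating a point from \<open>K\<close> has its normal in the dual cone,
  since \<open>K\<close> is closed under scaling; this contradicts membership in the bidual.\<close>

lemma dual_cone_dual_cone_subset:
  fixes K :: "'a::euclidean_space set"
  assumes "closed K" "convex_cone K"
  shows "dual_cone (dual_cone K) \<subseteq> K"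
proof (rule ccontr)
  assume "\<not> dual_cone (dual_cone K) \<subseteq> K"
  then obtain z where z: "z \<in> dual_cone (dual_cone K)" "z \<notin> K" by blast
  then obtain a c where ac: "a \<bullet> z < c" "\<And>x. x \<in> K \<Longrightarrow> c < a \<bullet> x"
    using separating_hyperplane_closed_point[of K z] assms unfolding convex_cone_def by auto
  have "c < 0"
    using ac(2)[of 0] convex_cone_contains_0[OF assms(2)] by simp
  have "0 \<le> x \<bullet> a" if "x \<in> K" for x
  proof (rule ccontr)
    assume "\<not> 0 \<le> x \<bullet> a"
    then have neg: "a \<bullet> x < 0" by (simp add: inner_commute)
    \<comment> \<open>The factor moves \<open>x\<close> onto the hyperplane itself, which
      \<open>K\<close> does not meet.\<close>
    then have "(c / (a \<bullet> x)) *\<^sub>R x \<in> K"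
      using \<open>c < 0\<close> that assms(2) by (intro convex_cone_scaleR) (auto intro: divide_nonpos_nonpos)
    from ac(2)[OF this] neg show False by simp
  qed
  then have "0 \<le> a \<bullet> z"
    using z(1) by (simp add: dual_cone_def)
  with ac(1) \<open>c < 0\<close> show False by simp
qed

lemma dual_arg_min_optimality:
  fixes f :: "'a::euclidean_space \<Rightarrow> real" and T :: "'a \<Rightarrow> 'b::euclidean_space"
  assumes sc: "strongly_convex \<mu> f" and mu: "0 < \<mu>" and T: "linear T"
    and K: "closed K" "convex_cone K"
    and opt: "is_arg_min (dual_objective f T b) (\<lambda>y. y \<in> dual_cone K) y0"
    and z: "convex_conjugate f (adjoint T y0) = adjoint T y0 \<bullet> z - f z"
  shows "T z + b \<in> K" and "(T z + b) \<bullet> y0 = 0"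
proof -
  have y0: "y0 \<in> dual_cone K"
    and min: "\<And>y. y \<in> dual_cone K \<Longrightarrow> dual_objective f T b y0 \<le> dual_objective f T b y"
    using opt by (auto simp: is_arg_min_linorder)
  interpret A: linear "adjoint T"
    by (rule adjoint_linear[OF T])
  \<comment> \<open>Along a feasible direction the descent estimate bounds the change of the dual
    objective by \<open>t * ((T z + b) \<bullet> d)\<close> plus a term of order
    \<open>t * t\<close>, so minimality fixes the sign of the linear term.\<close>
  have dir: "0 \<le> (T z + b) \<bullet> d" if d: "\<And>t. 0 < t \<Longrightarrow> t \<le> 1 \<Longrightarrow> y0 + t *\<^sub>R d \<in> dual_cone K" for d
  proof -
    define c where "c = (norm (adjoint T d))\<^sup>2 / (2 * \<mu>)"
    have "- ((T z + b) \<bullet> d) \<le> 0"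
    proof (rule nonpos_if_le_small_mult)
      fix t :: real assume t: "0 < t" "t \<le> 1"
      have "dual_objective f T b y0 \<le> dual_objective f T b (y0 + t *\<^sub>R d)"
        by (rule min[OF d[OF t]])
      also have "\<dots> \<le> dual_objective f T b y0 + t * ((T z + b) \<bullet> d) + t * (t * c)"
        using convex_conjugate_descent[OF sc mu z, of "t *\<^sub>R adjoint T d"]
        by (simp add: dual_objective_def A.add A.scaleR adjoint_clauses[OF T] c_def
            inner_add_left inner_add_right power_mult_distrib algebra_simps inner_commute
            power2_eq_square)
      finally have "t * (- ((T z + b) \<bullet> d)) \<le> t * (t * c)" by simp
      then show "- ((T z + b) \<bullet> d) \<le> t * c"
        using t by (simp only: mult_le_cancel_left_pos)
    qed
    then show ?thesis by simp
  qed
  have nonneg: "0 \<le> (T z + b) \<bullet> y" if "y \<in> dual_cone K" for y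
    using that y0 by (intro dir dual_cone_add dual_cone_scaleR) auto
  have "T z + b \<in> dual_cone (dual_cone K)"
    using nonneg unfolding dual_cone_def[of "dual_cone K"] by (simp add: inner_commute)
  then show "T z + b \<in> K"
    using dual_cone_dual_cone_subset[OF K] by blast
  \<comment> \<open>Shrinking \<open>y0\<close> towards the origin stays in the cone for
    \<open>t \<le> 1\<close>, so both \<open>y0\<close> and \<open>- y0\<close> are feasible
    directions; this gives complementary slackness.\<close>
  have "0 \<le> (T z + b) \<bullet> (- y0)"
  proof (rule dir)
    fix t :: real assume "0 < t" "t \<le> 1"
    then have "(1 - t) *\<^sub>R y0 \<in> dual_cone K"
      using y0 by (intro dual_cone_scaleR) auto
    then show "y0 + t *\<^sub>R - y0 \<in> dual_cone K"
      by (simp add: algebra_simps)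
  qed
  then show "(T z + b) \<bullet> y0 = 0"
    using nonneg[OF y0] by simp
qed

section \<open>The least eigenvalue of \<open>adjoint T \<circ> T\<close> and the operator
  norm\<close>

text \<open>Shows that the \<open>LEAST\<close> in \<open>min_eigenvalue\<close> is attained: the
  minimum of the Rayleigh quotient over the compact unit sphere is an eigenvalue and bounds all
  others from below.\<close>

lemma min_eigenvalue_adjoint_compose:
  fixes T :: "'a::euclidean_space \<Rightarrow> 'b::euclidean_space"
  assumes T: "linear T"
  shows "eigenvalue (adjoint T \<circ> T) (min_eigenvalue (adjoint T \<circ> T))"
proof -
  interpret T: linear T by fact
  have "compact (sphere (0::'a) 1)" "sphere (0::'a) 1 \<noteq> {}"
    using compact_sphere by (auto simp: sphere_eq_empty)
  moreover have "continuous_on (sphere 0 1) (\<lambda>v. (norm (T v))\<^sup>2)"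
    by (intro continuous_intros linear_continuous_on linear_conv_bounded_linear[THEN iffD1] T)
  ultimately obtain v where v: "v \<in> sphere 0 1"
    and vmin: "\<And>w. w \<in> sphere 0 1 \<Longrightarrow> (norm (T v))\<^sup>2 \<le> (norm (T w))\<^sup>2"
    using continuous_attains_inf[of "sphere (0::'a) 1" "\<lambda>v. (norm (T v))\<^sup>2"] by blast
  define l where "l = (norm (T v))\<^sup>2"
  define q where "q w = T w \<bullet> T w - l * (w \<bullet> w)" for w
  have vv: "v \<bullet> v = 1" using v by (simp add: dot_square_norm)
  have qv: "q v = 0" by (simp add: q_def l_def vv power2_norm_eq_inner)
  have q: "0 \<le> q w" for w
  proof (cases "w = 0")
    case False
    have "l \<le> (norm (T (w /\<^sub>R norm w)))\<^sup>2"
      unfolding l_def by (rule vmin) (use False in simp)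
    also have "\<dots> = (norm (T w))\<^sup>2 / (norm w)\<^sup>2"
      by (simp add: T.scaleR power_mult_distrib divide_inverse mult.commute power_inverse)
    finally show ?thesis
      using False by (simp add: q_def dot_square_norm field_simps)
  qed (simp add: q_def T.zero)
  \<comment> \<open>\<open>q \<ge> 0\<close> vanishes at \<open>v\<close>, so its first variation there is zero, which is the eigenvalue equation.\<close>
  have half: "0 \<le> T v \<bullet> T w - l * (v \<bullet> w)" for w
  proof -
    define B where "B = T v \<bullet> T w - l * (v \<bullet> w)"
    have "- 2 * B \<le> 0"
    proof (rule nonpos_if_le_small_mult)
      fix t :: real assume t: "0 < t" "t \<le> 1"
      have "q (v + t *\<^sub>R w) = q v + t * (2 * B) + t * (t * q w)"
        by (simp add: q_def B_def T.add T.scaleR inner_add_left inner_add_right inner_commute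
            algebra_simps)
      then have "t * (- 2 * B) \<le> t * (t * q w)"
        using q[of "v + t *\<^sub>R w"] qv by simp
      then show "- 2 * B \<le> t * q w"
        using t by (simp only: mult_le_cancel_left_pos)
    qed
    then show ?thesis by (simp add: B_def)
  qed
  have "T v \<bullet> T w = l * (v \<bullet> w)" for w
    using half[of w] half[of "- w"] by (simp add: T.neg)
  then have "adjoint T (T v) \<bullet> w = (l *\<^sub>R v) \<bullet> w" for w
    by (simp add: adjoint_clauses[OF T])
  then have "adjoint T (T v) = l *\<^sub>R v"
    using vector_eq_rdot by blast
  then have ev: "eigenvalue (adjoint T \<circ> T) l"
    unfolding eigenvalue_def using vv by (intro exI[of _ v]) auto
  moreover have "l \<le> m" if "eigenvalue (adjoint T \<circ> T) m" for m
  proof -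
    from that[unfolded eigenvalue_def comp_apply]
    obtain w where w: "w \<noteq> 0" "adjoint T (T w) = m *\<^sub>R w"
      by (elim exE conjE)
    then have "T w \<bullet> T w = m * (w \<bullet> w)"
      using adjoint_clauses(2)[OF T, of "T w" w] by simp
    then have "0 \<le> (m - l) * (w \<bullet> w)"
      using q[of w] by (simp add: q_def left_diff_distrib)
    moreover have "0 < w \<bullet> w" using w(1) by simp
    ultimately show ?thesis
      by (simp only: zero_le_mult_iff) auto
  qed
  ultimately have "min_eigenvalue (adjoint T \<circ> T) = l"
    unfolding min_eigenvalue_def by (intro Least_equality)
  with ev show ?thesis by simp
qed

text \<open>Pairing the eigenvector equation with \<open>v\<close> gives
  \<open>l * (norm v)\<^sup>2 = (norm (T v))\<^sup>2\<close>.\<close>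

lemma eigenvalue_adjoint_compose_le_onorm:
  fixes T :: "'a::euclidean_space \<Rightarrow> 'b::euclidean_space"
  assumes T: "linear T" and l: "eigenvalue (adjoint T \<circ> T) l"
  shows "l \<le> (onorm T)\<^sup>2"
proof -
  obtain v where v: "v \<noteq> 0" "adjoint T (T v) = l *\<^sub>R v"
    using l unfolding eigenvalue_def by auto
  have "l * (norm v)\<^sup>2 = (norm (T v))\<^sup>2"
    using adjoint_clauses(2)[OF T, of "T v" v] v(2) by (simp add: dot_square_norm)
  also have "\<dots> \<le> (onorm T * norm v)\<^sup>2"
    using onorm[OF linear_conv_bounded_linear[THEN iffD1, OF T], of v] by (intro power_mono) auto
  finally show ?thesis
    using v(1) by (simp add: power_mult_distrib)
qed

section \<open>Strong duality and the error bound for the iterates\<close>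

theorem theorem4p8:
  fixes f :: "'a::euclidean_space \<Rightarrow> real"
    and T :: "'a \<Rightarrow> 'b::euclidean_space"
    and b e :: 'b
    and K :: "'b set"
    and \<mu> c\<^sub>D :: real
    and x :: "nat \<Rightarrow> 'a" and y :: "nat \<Rightarrow> 'b"
  assumes "closed (epigraph UNIV f)"
    and "\<mu> > 0" and "strongly_convex \<mu> f"
    and "linear T"
    and "\<And>v. v \<noteq> 0 \<Longrightarrow> 0 < v \<bullet> (adjoint T \<circ> T) v"
    and "regular_cone K"
    and "e \<in> interior K" and "c\<^sub>D > 0"
    and "\<exists>y_opt. is_arg_min (dual_objective f T b) (\<lambda>y. y \<in> dual_cone K) y_opt
            \<and> e \<bullet> y_opt \<le> c\<^sub>D"
    and "\<And>k. y k \<in> dual_cone K"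
    and "\<And>k. e \<bullet> y k \<le> c\<^sub>D"
    and "\<And>k. GDERIV (convex_conjugate f) (adjoint T (y k)) :> x k"
    and "(\<lambda>k. dual_objective f T b (y k))
            \<longlonglongrightarrow> (INF y\<in>dual_cone K. dual_objective f T b y)"
  shows "min_eigenvalue (adjoint T \<circ> T) > 0 \<and>
    (\<exists>x_opt. (\<forall>z. is_arg_min f (\<lambda>z. T z + b \<in> K) z \<longleftrightarrow> z = x_opt) \<and>
       (\<forall>k. norm (x k - x_opt)
          \<le> sqrt (2 * (onorm T)\<^sup>2 / (\<mu> * min_eigenvalue (adjoint T \<circ> T)))
            * sqrt (dual_objective f T b (y k) - (INF y\<in>dual_cone K. dual_objective f T b y))))"
proof -
  note mu = assms(2) and sc = assms(3) and T = assms(4)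
  let ?h = "dual_objective f T b" and ?l = "min_eigenvalue (adjoint T \<circ> T)"
  let ?d = "INF y\<in>dual_cone K. ?h y"
  have K: "closed K" "convex_cone K"
    using assms(6) by (auto simp: regular_cone_def)

  have ev: "eigenvalue (adjoint T \<circ> T) ?l"
    by (rule min_eigenvalue_adjoint_compose[OF T])
  then obtain v where v: "v \<noteq> 0" "(adjoint T \<circ> T) v = ?l *\<^sub>R v"
    unfolding eigenvalue_def by blast
  have "0 < ?l * (v \<bullet> v)"
    using assms(5)[OF v(1)] unfolding v(2) by simp
  then have l_pos: "?l > 0"
    using v(1) by (meson inner_gt_zero_iff zero_less_mult_pos2)

  obtain y0 where opt: "is_arg_min ?h (\<lambda>y. y \<in> dual_cone K) y0"
    using assms(9) by blast
  then have y0: "y0 \<in> dual_cone K" and min: "\<And>y. y \<in> dual_cone K \<Longrightarrow> ?h y0 \<le> ?h y"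
    by (auto simp: is_arg_min_linorder)
  have d: "?d = ?h y0"
    using y0 min by (intro cInf_eq_minimum) auto
  obtain z where z: "convex_conjugate f (adjoint T y0) = adjoint T y0 \<bullet> z - f z"
    using convex_conjugate_attained[OF sc mu] .
  have feas: "T z + b \<in> K" and compl: "(T z + b) \<bullet> y0 = 0"
    using dual_arg_min_optimality[OF sc mu T K opt z] by auto
  have gap: "?d = - f z"
    using z compl unfolding d
    by (simp add: dual_objective_def adjoint_clauses[OF T] inner_add_left inner_add_right inner_commute)

  \<comment> \<open>Here \<open>y0\<close> acts as a Lagrange multiplier: its pairing with
    \<open>T w + b\<close> is nonnegative on the primal feasible set and vanishes at
    \<open>z\<close>.\<close>
  have growth: "f z + \<mu> / 2 * (norm (w - z))\<^sup>2 \<le> f w" if "T w + b \<in> K" for w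
  proof -
    have "0 \<le> (T w + b) \<bullet> y0"
      using y0 that by (simp add: dual_cone_def)
    moreover have "(T w + b) \<bullet> y0 = (T w + b) \<bullet> y0 - (T z + b) \<bullet> y0"
      using compl by simp
    ultimately show ?thesis
      using convex_conjugate_quadratic_growth[OF sc mu z, of w] z
      by (simp add: adjoint_clauses[OF T] inner_add_left inner_add_right inner_commute)
  qed
  have primal: "is_arg_min f (\<lambda>w. T w + b \<in> K) w \<longleftrightarrow> w = z" for w
  proof
    assume "is_arg_min f (\<lambda>w. T w + b \<in> K) w"
    then have "T w + b \<in> K" "f w \<le> f z"
      using feas by (auto simp: is_arg_min_linorder)
    with growth[of w] have "\<mu> / 2 * (norm (w - z))\<^sup>2 \<le> 0" by simp
    then show "w = z"
      using mu by (simp add: mult_le_0_iff)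
  next
    assume "w = z"
    moreover have "f z \<le> f u" if "T u + b \<in> K" for u
      using mu by (intro order_trans[OF _ growth[OF that]]) simp
    ultimately show "is_arg_min f (\<lambda>w. T w + b \<in> K) w"
      using feas by (auto simp: is_arg_min_linorder)
  qed

  have bound: "norm (x k - z) \<le> sqrt (2 * (onorm T)\<^sup>2 / (\<mu> * ?l)) * sqrt (?h (y k) - ?d)" for k
  proof -
    let ?s = "adjoint T (y k)"
    have "convex_conjugate f ?s = ?s \<bullet> x k - f (x k)"
      by (rule gradient_convex_conjugate_attains[OF sc mu assms(12)])
    from convex_conjugate_quadratic_growth[OF sc mu this, of z]
    have "\<mu> / 2 * (norm (x k - z))\<^sup>2 \<le> convex_conjugate f ?s + f z - ?s \<bullet> z"
      by (simp add: norm_minus_commute)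
    \<comment> \<open>Adding this nonnegative pairing cancels \<open>?s \<bullet> z\<close> and
      leaves \<open>b \<bullet> y k\<close>, which completes the dual objective.\<close>
    also have "\<dots> \<le> convex_conjugate f ?s + f z - ?s \<bullet> z + (T z + b) \<bullet> y k"
      using assms(10)[of k] feas by (simp add: dual_cone_def)
    also have "\<dots> = ?h (y k) - ?d"
      unfolding gap
      by (simp add: dual_objective_def adjoint_clauses[OF T] inner_add_left inner_add_right
          inner_commute)
    finally have "(norm (x k - z))\<^sup>2 \<le> 2 / \<mu> * (?h (y k) - ?d)"
      using mu by (simp add: field_simps)
    \<comment> \<open>The argument so far yields the constant \<open>2 / \<mu>\<close>; the factor
      \<open>(onorm T)\<^sup>2 / ?l\<close>, at least 1, brings it to the stated form.\<close>
    also have "\<dots> \<le> 2 * (onorm T)\<^sup>2 / (\<mu> * ?l) * (?h (y k) - ?d)"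
    proof (rule mult_right_mono)
      show "2 / \<mu> \<le> 2 * (onorm T)\<^sup>2 / (\<mu> * ?l)"
        using eigenvalue_adjoint_compose_le_onorm[OF T ev] mu l_pos by (simp add: field_simps)
      show "0 \<le> ?h (y k) - ?d"
        using min[OF assms(10)] d by simp
    qed
    finally show ?thesis
      unfolding real_sqrt_mult[symmetric] by (rule real_le_rsqrt)
  qed
  show ?thesis
  proof (intro conjI exI[of _ z] allI)
    show "?l > 0" by (rule l_pos)
  qed (rule primal, rule bound)
qed

end
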